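(* Let $\Gamma=\langle \mathcal{N},\Sigma,\mathcal{P}\rangle$ be an $\varepsilon$-free context-free grammar in Chomsky normal form, and let $G_\Gamma$ be the transition diagram associated with $\Gamma$ (defined in the context), with vertex set $V=\mathcal{N}\cup\{Z\}$, $Z\notin\mathcal{N}$. Let $A\in\mathcal{N}$ and $\alpha\in\Sigma^+$. Then $\alpha\in L(\Gamma,A)$ if and only if there is a walk $\pi$ in $G_\Gamma$ with start vertex $A$, end vertex $Z$ and label $l(\pi)=\langle\alpha,\varepsilon\rangle$.
   Context: An alphabet $\Sigma$ is a finite nonempty set; $\Sigma^*$ is the free monoid of words over $\Sigma$ under concatenation, with identity the empty word $\varepsilon$, and $\Sigma^+=\Sigma^*\setminus\{\varepsilon\}$. A context-free grammar is a triple $\Gamma=\langle\mathcal{N},\Sigma,\mathcal{P}\rangle$, where $\mathcal{N}$ (nonterminals) and $\Sigma$ (terminals) are finite disjoint sets and $\mathcal{P}$ is a finite subset of $\mathcal{N}\times(\mathcal{N}\cup\Sigma)^*$, whose elements are called productions and written $A\to\omega$. For $A\in\mathcal{N}$ write $A\Rightarrow\omega$ if $\omega\in(\mathcal{N}\cup\Sigma)^*$ can be derived from $A$ by a finite sequence of at least one production application, each step replacing one occurrence of a nonterminal $B$ by $\omega'$ for some production $B\to\omega'$. For $S\in\mathcal{N}$, $L(\Gamma,S)=\{\alpha\in\Sigma^* \mid S\Rightarrow\alpha\}$. The grammar is $\varepsilon$-free if $\varepsilon\notin L(\Gamma,S)$ for every $S\in\mathcal{N}$. It is in Chomsky normal form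 if every production has the form $A\to BC$ or $A\to a$ with $A,B,C\in\mathcal{N}$ and $a\in\Sigma$. The label monoid $W$. Let $\mathcal{N}'=\{A'\mid A\in\mathcal{N}\}$ be a disjoint copy of $\mathcal{N}$ ($\mathcal{N}\cap\mathcal{N}'=\emptyset$). Let $T$ be the monoid with set of generators $\mathcal{N}\cup\mathcal{N}'$ and defining relations $AA'=\varepsilon$ for all $A\in\mathcal{N}$, where $\varepsilon$ also denotes the identity of $T$. Let $W=\Sigma^*\times T=\{\langle\alpha,\omega\rangle\mid\alpha\in\Sigma^*,\ \omega\in T\}$ with componentwise product $\langle\alpha_1,\omega_1\rangle\circ\langle\alpha_2,\omega_2\rangle=\langle\alpha_1\alpha_2,\omega_1\omega_2\rangle$; this is a monoid with identity $\langle\varepsilon,\varepsilon\rangle$. The transition diagram $G_\Gamma$. It is the finite directed graph (multiple arcs between the same ordered pair of vertices are allowed, and loops are allowed) with vertex set $V=\mathcal{N}\cup\{Z\}$, where $Z\notin\mathcal{N}$, whose arcs are labeled by elements of $W$ and are exactly the following: (a) for $A\in\mathcal{N}$, $a\in\Sigma$: there is an arc $\overrightarrow{AZ}$ with label $\langle a,\varepsilon\rangle$ if and only if $A\to a$ is a production of $\Gamma$; (b) for $A,B,C\in\mathcal{N}$: there are arcs $\overrightarrow{AB}$ with label $\langle\varepsilon,C\rangle$ and $\overrightarrow{ZC}$ with label $\langle\varepsilon,C'\rangle$ if and only if $A\to BC$ is a production of $\Gamma$. That is, each production $A\to a$ contributes the arc in (a), each production $A\to BC$ contributes the two arcs in (b),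 and there are no other arcs. A walk is a finite sequence of consecutive arcs (with their vertices). The label $l(\pi)$ of a walk $\pi$ is the product in $W$ of the labels of its arcs, in the order in which they are traversed. *)

theory Defs
  imports "HOL-Algebra.Group" "Graph_Theory.Digraph" "Graph_Theory.Arc_Walk"
begin

text \<open>The datatype makes the nonterminals and the terminals disjoint.\<close>

datatype ('n, 't) sym = Nt 'n | Tm 't

record ('n, 't) cfg =
  nonterminals :: "'n set"
  terminals :: "'t set"
  productions :: "('n \<times> ('n, 't) sym list) set"

definition symbols :: "('n, 't) cfg \<Rightarrow> ('n, 't) sym set" where
  "symbols \<Gamma> = Nt ` nonterminals \<Gamma> \<union> Tm ` terminals \<Gamma>"

locale context_free_grammar =
  fixes \<Gamma> :: "('n, 't) cfg"
  assumes finite_nonterminals: "finite (nonterminals \<Gamma>)"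
    and finite_terminals: "finite (terminals \<Gamma>)"
    and finite_productions: "finite (productions \<Gamma>)"
    and productions_subset: "productions \<Gamma> \<subseteq> nonterminals \<Gamma> \<times> lists (symbols \<Gamma>)"

inductive step :: "('n, 't) cfg \<Rightarrow> ('n, 't) sym list \<Rightarrow> ('n, 't) sym list \<Rightarrow> bool"
  for \<Gamma> where
  "(B, \<omega>) \<in> productions \<Gamma> \<Longrightarrow> step \<Gamma> (u @ [Nt B] @ v) (u @ \<omega> @ v)"

definition derives :: "('n, 't) cfg \<Rightarrow> 'n \<Rightarrow> ('n, 't) sym list \<Rightarrow> bool" where
  "derives \<Gamma> A \<omega> \<longleftrightarrow> (step \<Gamma>)\<^sup>+\<^sup>+ [Nt A] \<omega>"

definition lang :: "('n, 't) cfg \<Rightarrow> 'n \<Rightarrow> 't list set" where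
  "lang \<Gamma> S = {\<alpha> \<in> lists (terminals \<Gamma>). derives \<Gamma> S (map Tm \<alpha>)}"

definition eps_free :: "('n, 't) cfg \<Rightarrow> bool" where
  "eps_free \<Gamma> \<longleftrightarrow> (\<forall>S \<in> nonterminals \<Gamma>. [] \<notin> lang \<Gamma> S)"

definition chomsky_normal_form :: "('n, 't) cfg \<Rightarrow> bool" where
  "chomsky_normal_form \<Gamma> \<longleftrightarrow> (\<forall>p \<in> productions \<Gamma>.
     (\<exists>A \<in> nonterminals \<Gamma>. \<exists>B \<in> nonterminals \<Gamma>. \<exists>C \<in> nonterminals \<Gamma>. p = (A, [Nt B, Nt C])) \<or>
     (\<exists>A \<in> nonterminals \<Gamma>. \<exists>a \<in> terminals \<Gamma>. p = (A, [Tm a])))"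

definition free_monoid :: "'a set \<Rightarrow> 'a list monoid" where
  "free_monoid X = \<lparr>carrier = lists X, mult = (@), one = []\<rparr>"

text \<open>The least congruence on the free monoid over \<open>X\<close> that contains the set \<open>R\<close> of
  pairs of words.\<close>

inductive_set pres_cong :: "'a set \<Rightarrow> ('a list \<times> 'a list) set \<Rightarrow> ('a list \<times> 'a list) set"
  for X R where
  rel: "(l, r) \<in> R \<Longrightarrow> u \<in> lists X \<Longrightarrow> v \<in> lists X \<Longrightarrow>
    (u @ l @ v, u @ r @ v) \<in> pres_cong X R"
| refl: "w \<in> lists X \<Longrightarrow> (w, w) \<in> pres_cong X R"
| sym: "(w, w') \<in> pres_cong X R \<Longrightarrow> (w', w) \<in> pres_cong X R"
| trans: "(w, w') \<in> pres_cong X R \<Longrightarrow> (w', w'') \<in> pres_cong X R \<Longrightarrow>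
    (w, w'') \<in> pres_cong X R"

definition word_class :: "'a set \<Rightarrow> ('a list \<times> 'a list) set \<Rightarrow> 'a list \<Rightarrow> 'a list set" where
  "word_class X R w = pres_cong X R `` {w}"

definition presented_monoid :: "'a set \<Rightarrow> ('a list \<times> 'a list) set \<Rightarrow> 'a list set monoid" where
  "presented_monoid X R =
    \<lparr>carrier = lists X // pres_cong X R,
     mult = (\<lambda>P Q. \<Union>p \<in> P. \<Union>q \<in> Q. word_class X R (p @ q)),
     one = word_class X R []\<rparr>"

lemma monoid_free_monoid: "monoid (free_monoid X)"
  by unfold_locales (auto simp: free_monoid_def)

lemma one_presented_monoid: "\<one>\<^bsub>presented_monoid X R\<^esub> = word_class X R []"
  by (simp add: presented_monoid_def)

context
  fixes X :: "'a set" and R :: "('a list \<times> 'a list) set"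
  assumes R_subset: "R \<subseteq> lists X \<times> lists X"
begin

lemma pres_cong_subset: "(w, w') \<in> pres_cong X R \<Longrightarrow> w \<in> lists X \<and> w' \<in> lists X"
  by (induction rule: pres_cong.induct) (use R_subset in auto)

lemma equiv_pres_cong: "equiv (lists X) (pres_cong X R)"
proof (rule equivI)
  show "pres_cong X R \<subseteq> lists X \<times> lists X"
    by (rule subrelI) (drule pres_cong_subset, simp only: mem_Times_iff fst_conv snd_conv)
  show "refl_on (lists X) (pres_cong X R)"
    by (rule refl_onI) (rule pres_cong.refl)
  show "Relation.sym (pres_cong X R)"
    by (rule symI) (rule pres_cong.sym)
  show "Relation.trans (pres_cong X R)"
    by (rule transI) (rule pres_cong.trans)
qed

lemma pres_cong_context:
  assumes "(w, w') \<in> pres_cong X R" "u \<in> lists X" "v \<in> lists X"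
  shows "(u @ w @ v, u @ w' @ v) \<in> pres_cong X R"
  using assms
proof (induction rule: pres_cong.induct)
  case (rel l r u' v')
  then show ?case
    using pres_cong.rel[of l r R "u @ u'" X "v' @ v"] by simp
next
  case (refl w)
  then show ?case
    by (intro pres_cong.refl) simp
next
  case (sym w w')
  then show ?case
    using pres_cong.sym by metis
next
  case (trans w w' w'')
  then show ?case
    using pres_cong.trans by metis
qed

lemma pres_cong_append:
  assumes "(p, p') \<in> pres_cong X R" "(q, q') \<in> pres_cong X R"
  shows "(p @ q, p' @ q') \<in> pres_cong X R"
proof (rule pres_cong.trans)
  show "(p @ q, p' @ q) \<in> pres_cong X R"
    using pres_cong_context[OF assms(1), of "[]" q] pres_cong_subset[OF assms(2)] by simp
  show "(p' @ q, p' @ q') \<in> pres_cong X R"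
    using pres_cong_context[OF assms(2), of p' "[]"] pres_cong_subset[OF assms(1)] by simp
qed

lemma word_class_eq_iff:
  "p \<in> lists X \<Longrightarrow> q \<in> lists X \<Longrightarrow>
    word_class X R p = word_class X R q \<longleftrightarrow> (p, q) \<in> pres_cong X R"
  unfolding word_class_def using eq_equiv_class_iff[OF equiv_pres_cong] by blast

lemma mult_word_class:
  assumes "p \<in> lists X" "q \<in> lists X"
  shows "word_class X R p \<otimes>\<^bsub>presented_monoid X R\<^esub> word_class X R q = word_class X R (p @ q)"
proof -
  let ?c = "word_class X R"
  have *: "?c (p' @ q') = ?c (p @ q)" if "p' \<in> ?c p" "q' \<in> ?c q" for p' q'
  proof -
    have "(p @ q, p' @ q') \<in> pres_cong X R"
      using that pres_cong_append by (simp add: word_class_def)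
    then show ?thesis
      unfolding word_class_def using equiv_class_eq[OF equiv_pres_cong] by metis
  qed
  have mem: "p \<in> ?c p" "q \<in> ?c q"
    using assms by (auto simp: word_class_def intro: pres_cong.refl)
  have "(\<Union>p' \<in> ?c p. \<Union>q' \<in> ?c q. ?c (p' @ q')) = (\<Union>p' \<in> ?c p. \<Union>q' \<in> ?c q. ?c (p @ q))"
    using * by (intro SUP_cong HOL.refl) simp
  also have "\<dots> = ?c (p @ q)"
    using mem by blast
  finally show ?thesis
    by (simp add: presented_monoid_def)
qed

lemma carrier_presented_monoid:
  "carrier (presented_monoid X R) = word_class X R ` lists X"
  by (auto simp: presented_monoid_def word_class_def quotient_def)

lemma monoid_presented_monoid: "monoid (presented_monoid X R)"
proof -
  have append: "p @ q \<in> lists X" if "p \<in> lists X" "q \<in> lists X" for p q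
    using that by simp
  show ?thesis
    by unfold_locales
      (simp_all add: one_presented_monoid carrier_presented_monoid,
        (elim imageE, simp add: mult_word_class append)+)
qed

end

text \<open>\<open>Push A\<close> is the generator \<open>A\<close>, and \<open>Pop A\<close> is its primed copy \<open>A'\<close>.\<close>

datatype 'n gen = Push 'n | Pop 'n

definition gens :: "('n, 't) cfg \<Rightarrow> 'n gen set" where
  "gens \<Gamma> = Push ` nonterminals \<Gamma> \<union> Pop ` nonterminals \<Gamma>"

definition rels :: "('n, 't) cfg \<Rightarrow> ('n gen list \<times> 'n gen list) set" where
  "rels \<Gamma> = {([Push A, Pop A], []) | A. A \<in> nonterminals \<Gamma>}"

definition T :: "('n, 't) cfg \<Rightarrow> 'n gen list set monoid" where
  "T \<Gamma> = presented_monoid (gens \<Gamma>) (rels \<Gamma>)"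

definition gen_elem :: "('n, 't) cfg \<Rightarrow> 'n gen \<Rightarrow> 'n gen list set" where
  "gen_elem \<Gamma> g = word_class (gens \<Gamma>) (rels \<Gamma>) [g]"

definition W :: "('n, 't) cfg \<Rightarrow> ('t list \<times> 'n gen list set) monoid" where
  "W \<Gamma> = free_monoid (terminals \<Gamma>) \<times>\<times> T \<Gamma>"

lemma rels_subset: "rels \<Gamma> \<subseteq> lists (gens \<Gamma>) \<times> lists (gens \<Gamma>)"
  by (auto simp: rels_def gens_def)

lemma monoid_W: "monoid (W \<Gamma>)"
  unfolding W_def T_def
  by (intro DirProd_monoid monoid_free_monoid monoid_presented_monoid rels_subset)

lemma push_pop:
  assumes "A \<in> nonterminals \<Gamma>"
  shows "gen_elem \<Gamma> (Push A) \<otimes>\<^bsub>T \<Gamma>\<^esub> gen_elem \<Gamma> (Pop A) = \<one>\<^bsub>T \<Gamma>\<^esub>"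
proof -
  have lists: "[Push A] \<in> lists (gens \<Gamma>)" "[Pop A] \<in> lists (gens \<Gamma>)"
      "[Push A, Pop A] \<in> lists (gens \<Gamma>)"
    using assms by (simp_all add: gens_def)
  have "([Push A, Pop A], []) \<in> rels \<Gamma>"
    using assms by (simp add: rels_def)
  from pres_cong.rel[OF this, of "[]" "gens \<Gamma>" "[]"]
  have "word_class (gens \<Gamma>) (rels \<Gamma>) [Push A, Pop A] = word_class (gens \<Gamma>) (rels \<Gamma>) []"
    using lists by (simp add: word_class_eq_iff[OF rels_subset])
  then show ?thesis
    using lists by (simp add: T_def gen_elem_def mult_word_class[OF rels_subset] one_presented_monoid)
qed

datatype 'n vertex = NT 'n | Z

text \<open>Each arc records the production that contributes it, so that parallel arcs stay distinct:
  \<open>Term_Arc A a\<close> comes from \<open>A \<rightarrow> a\<close>, and both \<open>Push_Arc A B C\<close>, from \<open>A\<close> to \<open>B\<close>, and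
  \<open>Pop_Arc A B C\<close>, from \<open>Z\<close> to \<open>C\<close>, come from \<open>A \<rightarrow> BC\<close>.\<close>

datatype ('n, 't) arc = Term_Arc 'n 't | Push_Arc 'n 'n 'n | Pop_Arc 'n 'n 'n

fun arc_tail :: "('n, 't) arc \<Rightarrow> 'n vertex" where
  "arc_tail (Term_Arc A a) = NT A"
| "arc_tail (Push_Arc A B C) = NT A"
| "arc_tail (Pop_Arc A B C) = Z"

fun arc_head :: "('n, 't) arc \<Rightarrow> 'n vertex" where
  "arc_head (Term_Arc A a) = Z"
| "arc_head (Push_Arc A B C) = NT B"
| "arc_head (Pop_Arc A B C) = NT C"

fun arc_label :: "('n, 't) cfg \<Rightarrow> ('n, 't) arc \<Rightarrow> 't list \<times> 'n gen list set" where
  "arc_label \<Gamma> (Term_Arc A a) = ([a], \<one>\<^bsub>T \<Gamma>\<^esub>)"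
| "arc_label \<Gamma> (Push_Arc A B C) = ([], gen_elem \<Gamma> (Push C))"
| "arc_label \<Gamma> (Pop_Arc A B C) = ([], gen_elem \<Gamma> (Pop C))"

definition transition_diagram ::
    "('n, 't) cfg \<Rightarrow> ('n vertex, ('n, 't) arc) pre_digraph" where
  "transition_diagram \<Gamma> =
    \<lparr>verts = NT ` nonterminals \<Gamma> \<union> {Z},
     arcs =
       {Term_Arc A a | A a. A \<in> nonterminals \<Gamma> \<and> a \<in> terminals \<Gamma> \<and>
          (A, [Tm a]) \<in> productions \<Gamma>} \<union>
       {Push_Arc A B C | A B C. A \<in> nonterminals \<Gamma> \<and> B \<in> nonterminals \<Gamma> \<and>
          C \<in> nonterminals \<Gamma> \<and> (A, [Nt B, Nt C]) \<in> productions \<Gamma>} \<union>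
       {Pop_Arc A B C | A B C. A \<in> nonterminals \<Gamma> \<and> B \<in> nonterminals \<Gamma> \<and>
          C \<in> nonterminals \<Gamma> \<and> (A, [Nt B, Nt C]) \<in> productions \<Gamma>},
     tail = arc_tail,
     head = arc_head\<rparr>"

definition walk_label :: "('n, 't) cfg \<Rightarrow> ('n, 't) arc list \<Rightarrow> 't list \<times> 'n gen list set" where
  "walk_label \<Gamma> \<pi> = foldr (\<lambda>e w. arc_label \<Gamma> e \<otimes>\<^bsub>W \<Gamma>\<^esub> w) \<pi> \<one>\<^bsub>W \<Gamma>\<^esub>"

lemma (in context_free_grammar) fin_digraph_transition_diagram:
  "fin_digraph (transition_diagram \<Gamma>)"
proof
  let ?N = "nonterminals \<Gamma>"
  let ?ts = "(\<lambda>(A, a). Term_Arc A a) ` (?N \<times> terminals \<Gamma>)"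
  let ?ps = "(\<lambda>(A, B, C). Push_Arc A B C) ` (?N \<times> ?N \<times> ?N)"
  let ?qs = "(\<lambda>(A, B, C). Pop_Arc A B C) ` (?N \<times> ?N \<times> ?N)"
  have "arcs (transition_diagram \<Gamma>) \<subseteq> ?ts \<union> ?ps \<union> ?qs"
  proof
    fix e assume "e \<in> arcs (transition_diagram \<Gamma>)"
    then show "e \<in> ?ts \<union> ?ps \<union> ?qs"
      by (cases e) (simp_all add: transition_diagram_def image_iff)
  qed
  then show "finite (arcs (transition_diagram \<Gamma>))"
    by (rule finite_subset)
      (intro finite_UnI finite_imageI finite_cartesian_product finite_nonterminals
        finite_terminals)
qed (auto simp: transition_diagram_def finite_nonterminals)

lemma arc_label_in_W:
  assumes "e \<in> arcs (transition_diagram \<Gamma>)"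
  shows "arc_label \<Gamma> e \<in> carrier (W \<Gamma>)"
proof -
  have gen: "gen_elem \<Gamma> g \<in> carrier (T \<Gamma>)" if "g \<in> gens \<Gamma>" for g
    unfolding T_def gen_elem_def carrier_presented_monoid[OF rels_subset]
    by (rule imageI) (simp add: that)
  have one: "\<one>\<^bsub>T \<Gamma>\<^esub> \<in> carrier (T \<Gamma>)"
    unfolding T_def by (rule monoid.one_closed[OF monoid_presented_monoid[OF rels_subset]])
  show ?thesis
  proof (cases e)
    case (Term_Arc A a)
    then show ?thesis
      using assms one by (simp add: transition_diagram_def W_def DirProd_def free_monoid_def)
  next
    case (Push_Arc A B C)
    then have "Push C \<in> gens \<Gamma>"
      using assms by (simp add: transition_diagram_def gens_def)
    then show ?thesis
      using Push_Arc gen by (simp add: W_def DirProd_def free_monoid_def)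
  next
    case (Pop_Arc A B C)
    then have "Pop C \<in> gens \<Gamma>"
      using assms by (simp add: transition_diagram_def gens_def)
    then show ?thesis
      using Pop_Arc gen by (simp add: W_def DirProd_def free_monoid_def)
  qed
qed

end

(* A vertex of the transition diagram together with a stack of nonterminals encodes a leftmost
   sentential form: (A, s) stands for A s, and (Z, s) stands for s. Term and push arcs apply a
   production to the first symbol, and pop arcs leave the form unchanged. The generators of T act
   on stacks by partial maps, and the action respects the defining relations, so a walk from A to
   Z with T-label 1 empties the stack and is a derivation from A. Conversely, the set of words
   read by such walks is closed under the productions: walks from B and from C combine to
   push C, walk from B, pop C, walk from C. *)

theory Submission
  imports Defs
begin

section \<open>Partial action of the generators of \<open>T\<close> on stacks\<close>

fun run :: "'n gen list \<Rightarrow> 'n list \<Rightarrow> 'n list option" where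
  "run [] s = Some s"
| "run (Push C # w) s = run w (C # s)"
| "run (Pop C # w) [] = None"
| "run (Pop C # w) (D # s) = (if C = D then run w s else None)"

lemma run_append: "run (u @ v) s = Option.bind (run u s) (run v)"
  by (induction u s rule: run.induct) auto

lemma run_push_pop: "run (Push C # Pop C # w) = run w"
  by (simp add: fun_eq_iff)

text \<open>A push followed by the matching pop restores every stack, and \<open>run_append\<close>
  carries this into any context. The order matters: \<open>Pop C\<close> before
  \<open>Push C\<close> is undefined on the empty stack, in accordance with the one-sided relations
  of \<open>T\<close>.\<close>

lemma run_pres_cong:
  assumes "(w, w') \<in> pres_cong (gens \<Gamma>) (rels \<Gamma>)"
  shows "run w = run w'"
  using assms by induction (auto simp: rels_def run_append run_push_pop fun_eq_iff)

section \<open>Representative words for walk labels\<close>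

fun arc_yield :: "('n, 't) arc \<Rightarrow> 't list" where
  "arc_yield (Term_Arc A a) = [a]"
| "arc_yield (Push_Arc A B C) = []"
| "arc_yield (Pop_Arc A B C) = []"

text \<open>A label has a congruence class as its second component; a chosen representative gives
  \<open>run\<close> a word to act on.\<close>

fun arc_gens :: "('n, 't) arc \<Rightarrow> 'n gen list" where
  "arc_gens (Term_Arc A a) = []"
| "arc_gens (Push_Arc A B C) = [Push C]"
| "arc_gens (Pop_Arc A B C) = [Pop C]"

abbreviation walk_yield :: "('n, 't) arc list \<Rightarrow> 't list" where
  "walk_yield \<pi> \<equiv> concat (map arc_yield \<pi>)"

abbreviation walk_gens :: "('n, 't) arc list \<Rightarrow> 'n gen list" where
  "walk_gens \<pi> \<equiv> concat (map arc_gens \<pi>)"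

lemma arc_gens_in_lists:
  "e \<in> arcs (transition_diagram \<Gamma>) \<Longrightarrow> arc_gens e \<in> lists (gens \<Gamma>)"
  by (cases e) (auto simp: transition_diagram_def gens_def)

lemma walk_gens_in_lists:
  "set \<pi> \<subseteq> arcs (transition_diagram \<Gamma>) \<Longrightarrow> walk_gens \<pi> \<in> lists (gens \<Gamma>)"
  using arc_gens_in_lists by fastforce

lemma arc_label_eq:
  "arc_label \<Gamma> e = (arc_yield e, word_class (gens \<Gamma>) (rels \<Gamma>) (arc_gens e))"
  by (cases e) (simp_all add: T_def one_presented_monoid gen_elem_def)

text \<open>Classes multiply by concatenating representatives as long as these are words over
  \<open>gens \<Gamma>\<close>, which the hypothesis on the arcs ensures.\<close>

lemma walk_label_eq:
  assumes "set \<pi> \<subseteq> arcs (transition_diagram \<Gamma>)"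
  shows "walk_label \<Gamma> \<pi> = (walk_yield \<pi>, word_class (gens \<Gamma>) (rels \<Gamma>) (walk_gens \<pi>))"
  using assms
proof (induction \<pi>)
  case Nil
  show ?case
    by (simp add: walk_label_def W_def DirProd_def free_monoid_def T_def one_presented_monoid)
next
  case (Cons e \<pi>)
  have "walk_label \<Gamma> (e # \<pi>) = arc_label \<Gamma> e \<otimes>\<^bsub>W \<Gamma>\<^esub> walk_label \<Gamma> \<pi>"
    by (simp add: walk_label_def)
  moreover have "arc_gens e \<in> lists (gens \<Gamma>)" "walk_gens \<pi> \<in> lists (gens \<Gamma>)"
    using Cons.prems arc_gens_in_lists walk_gens_in_lists[of \<pi> \<Gamma>] by auto
  ultimately show ?case
    using Cons by (simp add: arc_label_eq W_def DirProd_def free_monoid_def T_def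
        mult_word_class[OF rels_subset])
qed

lemma walk_label_eq_one_iff:
  assumes "set \<pi> \<subseteq> arcs (transition_diagram \<Gamma>)"
  shows "walk_label \<Gamma> \<pi> = (\<alpha>, \<one>\<^bsub>T \<Gamma>\<^esub>) \<longleftrightarrow>
    walk_yield \<pi> = \<alpha> \<and> (walk_gens \<pi>, []) \<in> pres_cong (gens \<Gamma>) (rels \<Gamma>)"
  using walk_gens_in_lists[OF assms]
  by (simp add: walk_label_eq[OF assms] T_def one_presented_monoid word_class_eq_iff[OF rels_subset])

section \<open>From walks to leftmost derivations\<close>

lemma step_append_left: "step \<Gamma> x y \<Longrightarrow> step \<Gamma> (w @ x) (w @ y)"
proof (induction rule: step.induct)
  case (1 B \<omega> u v)
  then show ?case
    using step.intros[of B \<omega> \<Gamma> "w @ u" v] by simp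
qed

lemma steps_append_left: "(step \<Gamma>)\<^sup>*\<^sup>* x y \<Longrightarrow> (step \<Gamma>)\<^sup>*\<^sup>* (w @ x) (w @ y)"
  by (induction rule: rtranclp_induct) (auto intro: step_append_left rtranclp.rtrancl_into_rtrancl)

fun sentential_form :: "'n vertex \<Rightarrow> 'n list \<Rightarrow> ('n, 't) sym list" where
  "sentential_form (NT A) s = map Nt (A # s)"
| "sentential_form Z s = map Nt s"

text \<open>Induction on the walk from its first arc. Start vertex and stack are both general
  because an arc changes them; the closure is reflexive because pop arcs use no production.\<close>

lemma awalk_imp_steps:
  assumes "pre_digraph.cas (transition_diagram \<Gamma>) v \<pi> Z"
    and "set \<pi> \<subseteq> arcs (transition_diagram \<Gamma>)"
    and "run (walk_gens \<pi>) s = Some []"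
  shows "(step \<Gamma>)\<^sup>*\<^sup>* (sentential_form v s) (map Tm (walk_yield \<pi>))"
  using assms
proof (induction \<pi> arbitrary: v s)
  case Nil
  then show ?case
    by (simp add: pre_digraph.cas.simps)
next
  case (Cons e \<pi>)
  have v: "v = arc_tail e" and cas: "pre_digraph.cas (transition_diagram \<Gamma>) (arc_head e) \<pi> Z"
    using Cons.prems(1) by (auto simp: pre_digraph.cas.simps transition_diagram_def)
  have e: "e \<in> arcs (transition_diagram \<Gamma>)" and \<pi>: "set \<pi> \<subseteq> arcs (transition_diagram \<Gamma>)"
    using Cons.prems(2) by auto
  note IH = Cons.IH[OF cas \<pi>]
  show ?case
  proof (cases e)
    case (Term_Arc A a)
    have "step \<Gamma> (sentential_form v s) (Tm a # map Nt s)"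
      using e v Term_Arc step.intros[of A "[Tm a]" \<Gamma> "[]" "map Nt s"]
      by (auto simp: transition_diagram_def)
    moreover have "(step \<Gamma>)\<^sup>*\<^sup>* (map Nt s) (map Tm (walk_yield \<pi>))"
      using IH[of s] Cons.prems(3) Term_Arc by simp
    \<comment> \<open>The emitted letter stays in front while the rest of the form is rewritten to
      its right.\<close>
    then have "(step \<Gamma>)\<^sup>*\<^sup>* (Tm a # map Nt s) (Tm a # map Tm (walk_yield \<pi>))"
      using steps_append_left[of \<Gamma> _ _ "[Tm a]"] by simp
    ultimately show ?thesis
      using Term_Arc by simp
  next
    case (Push_Arc A B C)
    have "step \<Gamma> (sentential_form v s) (sentential_form (NT B) (C # s))"
      using e v Push_Arc step.intros[of A "[Nt B, Nt C]" \<Gamma> "[]" "map Nt s"]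
      by (auto simp: transition_diagram_def)
    then show ?thesis
      using IH[of "C # s"] Cons.prems(3) Push_Arc by simp
  next
    case (Pop_Arc A B C)
    \<comment> \<open>Definedness of \<open>run\<close> forces \<open>C\<close> to be on top of the
      stack. Then \<open>(Z, C # s')\<close> and \<open>(NT C, s')\<close> encode the same
      sentential form.\<close>
    then obtain s' where "s = C # s'" "run (walk_gens \<pi>) s' = Some []"
      using Cons.prems(3) by (cases s) (auto split: if_splits)
    then show ?thesis
      using IH[of s'] v Pop_Arc by simp
  qed
qed

section \<open>From derivations to walks\<close>

fun reads :: "('n, 't) cfg \<Rightarrow> ('n, 't) sym \<Rightarrow> 't list \<Rightarrow> bool" where
  "reads \<Gamma> (Tm a) \<alpha> \<longleftrightarrow> \<alpha> = [a]"
| "reads \<Gamma> (Nt A) \<alpha> \<longleftrightarrow> (\<exists>\<pi>. pre_digraph.awalk (transition_diagram \<Gamma>) (NT A) \<pi> Z \<and>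
     walk_label \<Gamma> \<pi> = (\<alpha>, \<one>\<^bsub>T \<Gamma>\<^esub>))"

lemma reads_NtE:
  assumes "reads \<Gamma> (Nt A) \<alpha>"
  obtains \<pi> where "pre_digraph.cas (transition_diagram \<Gamma>) (NT A) \<pi> Z"
    and "set \<pi> \<subseteq> arcs (transition_diagram \<Gamma>)" and "walk_yield \<pi> = \<alpha>"
    and "(walk_gens \<pi>, []) \<in> pres_cong (gens \<Gamma>) (rels \<Gamma>)"
  using assms by (auto simp: pre_digraph.awalk_def walk_label_eq_one_iff)

lemma reads_NtI:
  assumes "A \<in> nonterminals \<Gamma>" "pre_digraph.cas (transition_diagram \<Gamma>) (NT A) \<pi> Z"
    and "set \<pi> \<subseteq> arcs (transition_diagram \<Gamma>)" and "walk_yield \<pi> = \<alpha>"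
    and "(walk_gens \<pi>, []) \<in> pres_cong (gens \<Gamma>) (rels \<Gamma>)"
  shows "reads \<Gamma> (Nt A) \<alpha>"
proof -
  have "pre_digraph.awalk (transition_diagram \<Gamma>) (NT A) \<pi> Z"
    using assms(1-3) by (simp add: pre_digraph.awalk_def) (simp add: transition_diagram_def)
  then show ?thesis
    using assms(3-5) walk_label_eq_one_iff[OF assms(3)] by auto
qed

lemma cas_append:
  "pre_digraph.cas G u p v \<Longrightarrow> pre_digraph.cas G v q w \<Longrightarrow> pre_digraph.cas G u (p @ q) w"
  by (induction p arbitrary: u) (auto simp: pre_digraph.cas.simps)

text \<open>The list \<open>\<alpha>s\<close> holds one word per symbol of the right-hand side, so
  both shapes of production fit one statement that applies to any derivation step.\<close>

lemma reads_production:
  assumes cnf: "chomsky_normal_form \<Gamma>" and prod: "(A, \<omega>) \<in> productions \<Gamma>"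
    and reads: "list_all2 (reads \<Gamma>) \<omega> \<alpha>s"
  shows "reads \<Gamma> (Nt A) (concat \<alpha>s)"
proof -
  let ?G = "transition_diagram \<Gamma>"
  have ends: "tail ?G = arc_tail" "head ?G = arc_head"
    by (simp_all add: transition_diagram_def)
  from cnf prod consider
    (pair) B C where "\<omega> = [Nt B, Nt C]" "A \<in> nonterminals \<Gamma>" "B \<in> nonterminals \<Gamma>"
      "C \<in> nonterminals \<Gamma>"
  | (single) a where "\<omega> = [Tm a]" "A \<in> nonterminals \<Gamma>" "a \<in> terminals \<Gamma>"
    unfolding chomsky_normal_form_def by blast
  then show ?thesis
  proof cases
    case single
    then have "concat \<alpha>s = [a]"
      using reads by (auto simp: list_all2_Cons1)
    moreover have "reads \<Gamma> (Nt A) [a]"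
      using single prod
      by (intro reads_NtI[of _ _ "[Term_Arc A a]"])
        (auto simp: pre_digraph.cas.simps ends intro: pres_cong.refl,
          auto simp: transition_diagram_def)
    ultimately show ?thesis
      by simp
  next
    case pair
    then obtain \<beta> \<gamma> where \<alpha>s: "\<alpha>s = [\<beta>, \<gamma>]" and "reads \<Gamma> (Nt B) \<beta>" "reads \<Gamma> (Nt C) \<gamma>"
      using reads by (auto simp: list_all2_Cons1)
    then obtain \<pi> \<rho> where
      \<pi>: "pre_digraph.cas ?G (NT B) \<pi> Z" "set \<pi> \<subseteq> arcs ?G" "walk_yield \<pi> = \<beta>"
        "(walk_gens \<pi>, []) \<in> pres_cong (gens \<Gamma>) (rels \<Gamma>)" and
      \<rho>: "pre_digraph.cas ?G (NT C) \<rho> Z" "set \<rho> \<subseteq> arcs ?G" "walk_yield \<rho> = \<gamma>"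
        "(walk_gens \<rho>, []) \<in> pres_cong (gens \<Gamma>) (rels \<Gamma>)"
      by (elim reads_NtE)
    \<comment> \<open>Both extra arcs come from the production at hand; the pop arc leads from
      \<open>Z\<close>, where \<open>\<pi>\<close> ends, to \<open>NT C\<close>, where
      \<open>\<rho>\<close> starts.\<close>
    let ?\<sigma> = "Push_Arc A B C # \<pi> @ Pop_Arc A B C # \<rho>"
    have C: "Push C \<in> gens \<Gamma>" "Pop C \<in> gens \<Gamma>" "([Push C, Pop C], []) \<in> rels \<Gamma>"
      using pair by (auto simp: gens_def rels_def)
    \<comment> \<open>Cancelling the word of \<open>\<pi>\<close> first makes push and pop adjacent,
      so that the defining relation applies; the word of \<open>\<rho>\<close> is cancelled
      last.\<close>
    have "([Push C] @ walk_gens \<pi> @ [Pop C], [Push C] @ [] @ [Pop C])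
        \<in> pres_cong (gens \<Gamma>) (rels \<Gamma>)"
      using C by (intro pres_cong_context[OF rels_subset \<pi>(4)]) auto
    also have "([Push C] @ [] @ [Pop C], []) \<in> pres_cong (gens \<Gamma>) (rels \<Gamma>)"
      using pres_cong.rel[OF C(3), of "[]" "gens \<Gamma>" "[]"] by simp
    finally (pres_cong.trans) have "(walk_gens ?\<sigma>, []) \<in> pres_cong (gens \<Gamma>) (rels \<Gamma>)"
      using pres_cong_append[OF rels_subset _ \<rho>(4)] by fastforce
    moreover have "pre_digraph.cas ?G (NT A) ?\<sigma> Z"
      using \<rho>(1) cas_append[OF \<pi>(1)] by (simp add: pre_digraph.cas.simps ends)
    moreover have "Push_Arc A B C \<in> arcs ?G" "Pop_Arc A B C \<in> arcs ?G"
      using pair prod by (auto simp: transition_diagram_def)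
    ultimately show ?thesis
      using pair(2) \<pi> \<rho> \<alpha>s by (intro reads_NtI[of _ _ ?\<sigma>]) auto
  qed
qed

text \<open>Undoing a step merges the words read by the symbols of \<open>\<omega>\<close> into a
  single word read by \<open>Nt B\<close>; the overall concatenation is unchanged.\<close>

lemma reads_step:
  assumes "chomsky_normal_form \<Gamma>" and "step \<Gamma> x y" and "list_all2 (reads \<Gamma>) y \<alpha>s"
  obtains \<beta>s where "list_all2 (reads \<Gamma>) x \<beta>s" and "concat \<beta>s = concat \<alpha>s"
  using assms(2)
proof cases
  case (1 B \<omega> u v)
  then obtain us ws vs where \<alpha>s: "\<alpha>s = us @ ws @ vs" and parts: "list_all2 (reads \<Gamma>) u us"
    "list_all2 (reads \<Gamma>) \<omega> ws" "list_all2 (reads \<Gamma>) v vs"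
    using assms(3) by (auto simp: list_all2_append1)
  have "list_all2 (reads \<Gamma>) x (us @ [concat ws] @ vs)"
    unfolding 1 using parts reads_production[OF assms(1) 1(3) parts(2)]
    by (intro list_all2_appendI) auto
  then show thesis
    by (rule that) (simp add: \<alpha>s)
qed

lemma reads_steps:
  assumes "chomsky_normal_form \<Gamma>" and "(step \<Gamma>)\<^sup>*\<^sup>* x (map Tm \<alpha>)"
  shows "\<exists>\<alpha>s. list_all2 (reads \<Gamma>) x \<alpha>s \<and> concat \<alpha>s = \<alpha>"
  using assms(2)
proof (induction rule: converse_rtranclp_induct)
  case base
  \<comment> \<open>The induction runs backward from the terminal word, in which each letter reads
    itself.\<close>
  have "list_all2 (reads \<Gamma>) (map Tm \<alpha>) (map (\<lambda>a. [a]) \<alpha>)"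
    by (simp add: list_all2_conv_all_nth)
  moreover have "concat (map (\<lambda>a. [a]) \<alpha>) = \<alpha>"
    by simp
  ultimately show ?case
    by blast
next
  case (step x y)
  then show ?case
    using reads_step[OF assms(1)] by metis
qed

theorem theorem1:
  fixes \<Gamma> :: "('n, 't) cfg" and A :: 'n and \<alpha> :: "'t list"
  assumes "context_free_grammar \<Gamma>"
    and "eps_free \<Gamma>"
    and "chomsky_normal_form \<Gamma>"
    and "A \<in> nonterminals \<Gamma>"
    and "\<alpha> \<in> lists (terminals \<Gamma>)" and "\<alpha> \<noteq> []"
  shows "\<alpha> \<in> lang \<Gamma> A \<longleftrightarrow>
    (\<exists>\<pi>. pre_digraph.awalk (transition_diagram \<Gamma>) (NT A) \<pi> Z \<and>
         walk_label \<Gamma> \<pi> = (\<alpha>, \<one>\<^bsub>T \<Gamma>\<^esub>))"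
proof -
  have "\<alpha> \<in> lang \<Gamma> A \<longleftrightarrow> reads \<Gamma> (Nt A) \<alpha>"
  proof
    assume "\<alpha> \<in> lang \<Gamma> A"
    then have "(step \<Gamma>)\<^sup>*\<^sup>* [Nt A] (map Tm \<alpha>)"
      by (simp add: lang_def derives_def tranclp_into_rtranclp)
    then show "reads \<Gamma> (Nt A) \<alpha>"
      using reads_steps[OF assms(3)] by (fastforce simp: list_all2_Cons1)
  next
    assume "reads \<Gamma> (Nt A) \<alpha>"
    then obtain \<pi> where \<pi>: "pre_digraph.cas (transition_diagram \<Gamma>) (NT A) \<pi> Z"
        "set \<pi> \<subseteq> arcs (transition_diagram \<Gamma>)" "walk_yield \<pi> = \<alpha>"
        "(walk_gens \<pi>, []) \<in> pres_cong (gens \<Gamma>) (rels \<Gamma>)"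
      by (rule reads_NtE)
    \<comment> \<open>A word congruent to \<open>[]\<close> acts as the identity. The empty stack is
      chosen because \<open>(NT A, [])\<close> encodes \<open>[Nt A]\<close>.\<close>
    have "run (walk_gens \<pi>) [] = Some []"
      using run_pres_cong[OF \<pi>(4)] by simp
    from awalk_imp_steps[OF \<pi>(1,2) this] have "(step \<Gamma>)\<^sup>*\<^sup>* [Nt A] (map Tm \<alpha>)"
      using \<pi>(3) by simp
    \<comment> \<open>\<open>derives\<close> demands at least one step, so the reflexive case has to
      be excluded.\<close>
    moreover have "[Nt A] \<noteq> map Tm \<alpha>"
      by (cases \<alpha>) auto
    ultimately show "\<alpha> \<in> lang \<Gamma> A"
      using assms(5) by (auto simp: lang_def derives_def dest: rtranclpD)
  qed
  then show ?thesis
    by simp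
qed

end
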